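(* Let $T>0$. For every $x\in\mathbb{R}^2$, the number of base stations covering $x$ is distributed according to the Poisson distribution of parameter $\lambda_B B(T)$. In particular, the outage probability given the threshold $T$ is $$P(\xi_0^x>T)=e^{-\lambda_B B(T)}.$$
   Context: Base stations: $\Pi_B=\{y_0,y_1,\dots\}$ is a homogeneous Poisson point process on $\mathbb{R}^2$ of intensity $\lambda_B>0$. Path loss: $L:\mathbb{R}^2\to(0,\infty)$ is a measurable function (values on a Lebesgue-null set are irrelevant). Fading: $H$ is a nonnegative random variable with probability density function $p_H$ and complementary cumulative distribution function $F_H(\beta)=P(H\ge\beta)=\int_\beta^\infty p_H(t)\,dt$, assumed to satisfy $F_H(\beta)>0$ for all $\beta$. For fixed $x\in\mathbb{R}^2$, the fading variables $h_{y_i x}$, $i\ge0$, are independent copies of $H$, independent of $\Pi_B$. Define $B(\beta)=\int_{\mathbb{R}^2}F_H\big((L(z)\beta)^{-1}\big)\,dz$ for $\beta>0$; it is assumed that $0<B(\beta)<\infty$ for all $\beta>0$. For $x\in\mathbb{R}^2$ set $s_i^x=\big(h_{y_i x}L(y_i-x)\big)^{-1}$ (path loss fading); the points of $\{s_i^x\}_{i\ge0}$ arranged in increasing order are denoted $\xi_0^x<\xi_1^x<\cdots$. The base station $y_i$ covers $x$ if $s_i^x\le T$ (equivalently, the received signal power, which is the transmission power divided by $s_i^x$, is at least the transmission power divided by $T$). The point $x$ is in outage if no base station covers it. *)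

theory Defs
  imports "HOL-Probability.Probability" "HOL-Library.Extended_Nat"
begin

definition ecard :: "'b set \<Rightarrow> enat" where
  "ecard S = (if finite S then enat (card S) else \<infinity>)"

(* The library's poisson_pmf needs a positive rate; rate 0 is the point mass at 0. *)
definition poisson_law :: "real \<Rightarrow> enat pmf" where
  "poisson_law r = map_pmf enat (if r = 0 then return_pmf 0 else poisson_pmf r)"

definition poisson_distributed :: "'w measure \<Rightarrow> ('w \<Rightarrow> enat) \<Rightarrow> real \<Rightarrow> bool" where
  "poisson_distributed M N r \<longleftrightarrow>
     N \<in> measurable M (count_space UNIV) \<and>
     distr M (count_space UNIV) N = measure_pmf (poisson_law r)"

(* A point process is given by a measurable enumeration y 0, y 1, ... of its points; its
   counting measure is the sum of the Dirac masses at the y i, so that an index counts once. *)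
definition point_count :: "(nat \<Rightarrow> 'w \<Rightarrow> 'a) \<Rightarrow> 'a set \<Rightarrow> 'w \<Rightarrow> enat" where
  "point_count y A \<omega> = ecard {i. y i \<omega> \<in> A}"

definition homogeneous_poisson_process ::
    "'w measure \<Rightarrow> real \<Rightarrow> (nat \<Rightarrow> 'w \<Rightarrow> 'a::euclidean_space) \<Rightarrow> bool" where
  "homogeneous_poisson_process M \<mu> y \<longleftrightarrow>
     (\<forall>i. y i \<in> borel_measurable M) \<and>
     (\<forall>A \<in> sets borel. emeasure lborel A < \<infinity> \<longrightarrow>
        poisson_distributed M (point_count y A) (\<mu> * measure lborel A)) \<and>
     (\<forall>(A :: nat \<Rightarrow> 'a set) J. finite J \<and> disjoint_family_on A J \<and>
        (\<forall>j\<in>J. A j \<in> sets borel \<and> emeasure lborel (A j) < \<infinity>) \<longrightarrow>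
        prob_space.indep_vars M (\<lambda>_. count_space UNIV) (\<lambda>j. point_count y (A j)) J)"

definition ccdf :: "'w measure \<Rightarrow> ('w \<Rightarrow> real) \<Rightarrow> real \<Rightarrow> real" where
  "ccdf M X \<beta> = measure M {\<omega> \<in> space M. X \<omega> \<ge> \<beta>}"

definition mean_coverage_area ::
    "'w measure \<Rightarrow> ('w \<Rightarrow> real) \<Rightarrow> ('a::euclidean_space \<Rightarrow> real) \<Rightarrow> real \<Rightarrow> ennreal" where
  "mean_coverage_area M H L \<beta> = (\<integral>\<^sup>+ z. ennreal (ccdf M H (inverse (L z * \<beta>))) \<partial>lborel)"

(* Here h i x is the fading between y i and x. The value is taken in ennreal because the
   inverse of 0 is then infinity: a station with zero fading covers nothing. *)
definition path_loss_fading ::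
    "(nat \<Rightarrow> 'w \<Rightarrow> 'a::euclidean_space) \<Rightarrow> (nat \<Rightarrow> 'a \<Rightarrow> 'w \<Rightarrow> real) \<Rightarrow> ('a \<Rightarrow> real) \<Rightarrow>
     'a \<Rightarrow> nat \<Rightarrow> 'w \<Rightarrow> ennreal" where
  "path_loss_fading y h L x i \<omega> = inverse (ennreal (h i x \<omega> * L (y i \<omega> - x)))"

definition covers ::
    "(nat \<Rightarrow> 'w \<Rightarrow> 'a::euclidean_space) \<Rightarrow> (nat \<Rightarrow> 'a \<Rightarrow> 'w \<Rightarrow> real) \<Rightarrow> ('a \<Rightarrow> real) \<Rightarrow>
     real \<Rightarrow> 'a \<Rightarrow> nat \<Rightarrow> 'w \<Rightarrow> bool" where
  "covers y h L T x i \<omega> \<longleftrightarrow> path_loss_fading y h L x i \<omega> \<le> ennreal T"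

definition num_covering ::
    "(nat \<Rightarrow> 'w \<Rightarrow> 'a::euclidean_space) \<Rightarrow> (nat \<Rightarrow> 'a \<Rightarrow> 'w \<Rightarrow> real) \<Rightarrow> ('a \<Rightarrow> real) \<Rightarrow>
     real \<Rightarrow> 'a \<Rightarrow> 'w \<Rightarrow> enat" where
  "num_covering y h L T x \<omega> = ecard {i. covers y h L T x i \<omega>}"

definition outage ::
    "(nat \<Rightarrow> 'w \<Rightarrow> 'a::euclidean_space) \<Rightarrow> (nat \<Rightarrow> 'a \<Rightarrow> 'w \<Rightarrow> real) \<Rightarrow> ('a \<Rightarrow> real) \<Rightarrow>
     real \<Rightarrow> 'a \<Rightarrow> 'w \<Rightarrow> bool" where
  "outage y h L T x \<omega> \<longleftrightarrow> (\<nexists>i. covers y h L T x i \<omega>)"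

primrec increasing_arrangement :: "'b::complete_linorder set \<Rightarrow> nat \<Rightarrow> 'b" where
  "increasing_arrangement S 0 = Inf S"
| "increasing_arrangement S (Suc k) = Inf {s \<in> S. increasing_arrangement S k < s}"

lemma increasing_arrangement_range:
  fixes f :: "nat \<Rightarrow> 'b::complete_linorder"
  assumes "strict_mono f"
  shows "increasing_arrangement (range f) k = f k"
proof (induction k)
  case 0
  have "mono f" using assms by (rule strict_mono_mono)
  then show ?case by (auto intro!: Inf_eqI simp: monoD)
next
  case (Suc k)
  have "{s \<in> range f. f k < s} = f ` {Suc k..}"
    using assms by (auto simp: strict_mono_less)
  moreover have "Inf (f ` {Suc k..}) = f (Suc k)"
    using strict_mono_mono[OF assms] by (intro Inf_eqI) (auto simp: monoD)
  ultimately show ?case using Suc.IH by simp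
qed

definition ordered_fading ::
    "(nat \<Rightarrow> 'w \<Rightarrow> 'a::euclidean_space) \<Rightarrow> (nat \<Rightarrow> 'a \<Rightarrow> 'w \<Rightarrow> real) \<Rightarrow> ('a \<Rightarrow> real) \<Rightarrow>
     'a \<Rightarrow> nat \<Rightarrow> 'w \<Rightarrow> ennreal" where
  "ordered_fading y h L x k \<omega> =
     increasing_arrangement (range (\<lambda>i. path_loss_fading y h L x i \<omega>)) k"

end

theory Submission
  imports Defs
begin

text \<open>
  Attach to every base station its fading towards \<open>x\<close>. A station at \<open>z\<close> with fading \<open>w\<close> covers
  \<open>x\<close> exactly when the pair \<open>(z, w)\<close> lies in the region \<open>w * L (z - x) \<ge> 1 / T\<close>, so, given the
  stations, each one at \<open>z\<close> covers \<open>x\<close> independently with probability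
  \<open>q z = P (H * L (z - x) \<ge> 1 / T)\<close>. The covering stations are thus a thinning of a Poisson process,
  and their number is Poisson with parameter \<open>\<lambda>\<^sub>B * \<integral> q\<close>; by translation invariance of Lebesgue
  measure the integral is \<open>B T\<close>.

  The thinning principle (\<open>marked_poisson_process_count\<close>) is proved with generating functions.
  If \<open>N\<close> is the number of covering stations, then \<open>s ^ N\<close> is the limit over \<open>k\<close> of the product over
  the first \<open>k\<close> stations of \<open>s\<close> or \<open>1\<close>, according to whether the station covers. Integrating out the
  fading (\<open>expectation_prod_thinning\<close>) replaces the factor of a station at \<open>z\<close> by
  \<open>1 - (1 - s) * q z\<close>. The expectation of the resulting product over a Poisson process is the
  classical generating functional \<open>exp (- \<mu> * \<integral> (1 - s) * q)\<close> (\<open>poisson_process_pgfl\<close>), and as a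
  function of \<open>s\<close> this is the generating function of a Poisson variable, which determines the
  distribution (\<open>poisson_distributedI_pgf\<close>).

  For the outage probability, \<open>\<xi>\<^sub>0\<close> is an infimum, and \<open>\<xi>\<^sub>0 > T\<close> is a priori stronger than the absence
  of a value \<open>\<le> T\<close>. The two agree almost surely because the counting result at the threshold \<open>T + 1\<close>
  shows that almost surely only finitely many values lie below \<open>T + 1\<close>, so that they cannot accumulate
  at \<open>T\<close>.
\<close>

section \<open>Counting with values in the extended naturals\<close>

text \<open>
  The value at \<open>\<infinity>\<close> is the limit of \<open>s ^ n\<close>. With it, products over infinitely many points can be
  evaluated for every \<open>s\<close> in the closed unit interval, whether or not the number of points is finite.
\<close>

definition enat_power :: "real \<Rightarrow> enat \<Rightarrow> real" where
  "enat_power s n = (case n of enat k \<Rightarrow> s ^ k | \<infinity> \<Rightarrow> if s = 1 then 1 else 0)"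

lemma abs_enat_power_le_1: "0 \<le> s \<Longrightarrow> s \<le> 1 \<Longrightarrow> \<bar>enat_power s n\<bar> \<le> 1"
  by (auto simp: enat_power_def power_le_one split: enat.split)

lemma prod_if_tendsto_enat_power:
  fixes C :: "nat \<Rightarrow> bool" and s :: real
  assumes s: "0 \<le> s" "s \<le> 1"
  shows "(\<lambda>k. \<Prod>i<k. if C i then s else 1) \<longlonglongrightarrow> enat_power s (ecard {i. C i})"
proof -
  have eq: "(\<Prod>i<k. if C i then s else 1) = s ^ card {i. i < k \<and> C i}" for k
    by (simp add: prod.If_cases Collect_conj_eq lessThan_def)
  show ?thesis
  proof (cases "finite {i. C i}")
    case True
    then obtain K where K: "\<And>i. C i \<Longrightarrow> i < K"
      by (auto simp: finite_nat_set_iff_bounded)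
    have "{i. i < k \<and> C i} = {i. C i}" if "k \<ge> K" for k
      using K that by force
    then have "\<forall>\<^sub>F k in sequentially. s ^ card {i. i < k \<and> C i} = enat_power s (ecard {i. C i})"
      using True by (intro eventually_sequentiallyI[of K]) (simp add: enat_power_def ecard_def)
    then show ?thesis
      unfolding eq by (rule tendsto_eventually)
  next
    case False
    show ?thesis
    proof (cases "s = 1")
      case True
      then have "(\<Prod>i<k. if C i then s else 1) = 1" for k
        by (simp add: eq)
      then show ?thesis using False True by (simp add: enat_power_def ecard_def)
    next
      case s1: False
      have "filterlim (\<lambda>k. card {i. i < k \<and> C i}) at_top sequentially"
        unfolding filterlim_at_top
      proof
        fix n
        obtain F where F: "F \<subseteq> {i. C i}" "finite F" "card F = n"
          using infinite_arbitrarily_large[OF False] by blast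
        then obtain K where K: "\<And>i. i \<in> F \<Longrightarrow> i < K"
          by (auto simp: finite_nat_set_iff_bounded)
        have "n \<le> card {i. i < k \<and> C i}" if "k \<ge> K" for k
          unfolding F(3)[symmetric] using F K that by (intro card_mono) force+
        then show "\<forall>\<^sub>F k in sequentially. n \<le> card {i. i < k \<and> C i}"
          by (auto simp: eventually_sequentially)
      qed
      then have "(\<lambda>k. s ^ card {i. i < k \<and> C i}) \<longlonglongrightarrow> 0"
        using s s1 by (intro filterlim_compose[OF LIMSEQ_realpow_zero]) auto
      then show ?thesis
        unfolding eq using False s1 by (simp add: enat_power_def ecard_def)
    qed
  qed
qed

text \<open>
  Finite values suffice: \<open>\<infinity>\<close> is the complement of them, and there are only countably many.
\<close>

lemma pred_eq_enat_imp_measurable: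
  fixes N :: "'w \<Rightarrow> enat"
  assumes "\<And>n. Measurable.pred M (\<lambda>\<omega>. N \<omega> = enat n)"
  shows "N \<in> measurable M (count_space UNIV)"
proof (subst measurable_count_space_eq_countable)
  have "N -` {a} \<inter> space M \<in> sets M" for a
  proof (cases a)
    case (enat n)
    then show ?thesis using assms[of n] by (simp add: pred_def vimage_def Int_def conj_commute)
  next
    case infinity
    have "Measurable.pred M (\<lambda>\<omega>. \<forall>n. \<not> N \<omega> = enat n)"
      using assms by measurable
    also have "(\<lambda>\<omega>. \<forall>n. \<not> N \<omega> = enat n) = (\<lambda>\<omega>. N \<omega> = \<infinity>)"
      by (metis (no_types) enat.exhaust infinity_ne_i0 enat.distinct(1))
    finally show ?thesis using infinity by (simp add: pred_def vimage_def Int_def conj_commute)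
  qed
  then show "N \<in> space M \<rightarrow> UNIV \<and> (\<forall>a\<in>UNIV. N -` {a} \<inter> space M \<in> sets M)"
    by auto
qed (simp add: countableI_type)

lemma measurable_ecard_Collect:
  fixes C :: "nat \<Rightarrow> 'w \<Rightarrow> bool"
  assumes [measurable]: "\<And>i. Measurable.pred M (C i)"
  shows "(\<lambda>\<omega>. ecard {i. C i \<omega>}) \<in> measurable M (count_space UNIV)"
proof (rule pred_eq_enat_imp_measurable)
  fix n
  \<comment> \<open>a count of \<open>n\<close> means that the set of indices is one of the countably many \<open>n\<close>-element sets\<close>
  let ?F = "{F :: nat set. finite F \<and> card F = n}"
  have "countable ?F"
    by (rule countable_subset[OF _ countable_Collect_finite]) auto
  then have "Measurable.pred M (\<lambda>\<omega>. \<exists>F\<in>?F. \<forall>i. C i \<omega> \<longleftrightarrow> i \<in> F)"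
    by measurable
  also have "(\<lambda>\<omega>. \<exists>F\<in>?F. \<forall>i. C i \<omega> \<longleftrightarrow> i \<in> F) = (\<lambda>\<omega>. ecard {i. C i \<omega>} = enat n)"
  proof (intro ext iffI)
    fix \<omega> assume "\<exists>F\<in>?F. \<forall>i. C i \<omega> \<longleftrightarrow> i \<in> F"
    then obtain F where "F \<in> ?F" "{i. C i \<omega>} = F" by auto
    then show "ecard {i. C i \<omega>} = enat n" by (simp add: ecard_def)
  next
    fix \<omega> assume "ecard {i. C i \<omega>} = enat n"
    then show "\<exists>F\<in>?F. \<forall>i. C i \<omega> \<longleftrightarrow> i \<in> F"
      by (intro bexI[of _ "{i. C i \<omega>}"]) (auto simp: ecard_def split: if_splits)
  qed
  finally show "Measurable.pred M (\<lambda>\<omega>. ecard {i. C i \<omega>} = enat n)" .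
qed

section \<open>Probability generating functions\<close>

text \<open>
  One-sided uniqueness of power series: generating functions are available only for \<open>s\<close> between
  \<open>0\<close> and \<open>1\<close>. Once the first \<open>m\<close> coefficients vanish, dividing by \<open>s ^ m\<close> and letting \<open>s\<close> decrease
  to \<open>0\<close> leaves the next one.
\<close>

lemma powser_eq_0_right_imp_coeff_eq_0:
  fixes a :: "nat \<Rightarrow> real"
  assumes "\<And>s. 0 < s \<Longrightarrow> s < 1 \<Longrightarrow> (\<lambda>n. a n * s ^ n) sums 0"
  shows "a m = 0"
proof (induction m rule: less_induct)
  case (less m)
  have shifted: "(\<lambda>n. a (n + m) * s ^ n) sums 0" if s: "0 < s" "s < 1" for s
  proof -
    have "(\<lambda>n. a (n + m) * s ^ (n + m)) sums (0 - (\<Sum>i<m. a i * s ^ i))"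
      using assms[OF s] by (rule sums_split_initial_segment)
    then have "(\<lambda>n. inverse (s ^ m) * (a (n + m) * s ^ (n + m))) sums (inverse (s ^ m) * 0)"
      using less by (intro sums_mult) simp
    moreover have "inverse (s ^ m) * (a (n + m) * s ^ (n + m)) = a (n + m) * s ^ n" for n
      using s by (simp add: power_add field_simps)
    ultimately show ?thesis by simp
  qed
  have "isCont (\<lambda>s. \<Sum>n. a (n + m) * s ^ n) 0"
    by (rule isCont_powser[of _ "1/2"]) (use shifted[of "1/2"] in \<open>auto simp: sums_iff\<close>)
  then have "((\<lambda>s. \<Sum>n. a (n + m) * s ^ n) \<longlongrightarrow> a m) (at_right 0)"
    by (auto simp: isCont_def intro: tendsto_within_subset)
  moreover have "\<forall>\<^sub>F s in at_right 0. (\<Sum>n. a (n + m) * s ^ n) = 0"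
    unfolding eventually_at_right_field using shifted
    by (intro exI[of _ 1]) (auto simp: sums_iff)
  then have "((\<lambda>s. \<Sum>n. a (n + m) * s ^ n) \<longlongrightarrow> 0) (at_right 0)"
    by (rule tendsto_eventually)
  ultimately show "a m = 0"
    by (rule tendsto_unique[rotated]) simp
qed

lemma pmf_poisson_law_enat:
  assumes "0 \<le> r"
  shows "pmf (poisson_law r) (enat n) = r ^ n / fact n * exp (- r)"
proof -
  have "pmf (poisson_law r) (enat n) = pmf (if r = 0 then return_pmf 0 else poisson_pmf r) n"
    unfolding poisson_law_def by (rule pmf_map_inj') (simp add: inj_def)
  then show ?thesis
    using assms by (auto simp: pmf_return indicator_def zero_power)
qed

context prob_space
begin

text \<open>
  The mass of \<open>N\<close> at \<open>\<infinity>\<close> does not enter, since \<open>enat_power s \<infinity> = 0\<close> for \<open>s < 1\<close>.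
\<close>

lemma enat_power_expectation_sums:
  assumes N: "N \<in> measurable M (count_space UNIV)" and s: "0 \<le> s" "s < 1"
  shows "(\<lambda>n. prob {\<omega> \<in> space M. N \<omega> = enat n} * s ^ n) sums expectation (\<lambda>\<omega>. enat_power s (N \<omega>))"
proof -
  note N[measurable]
  define g where "g k \<omega> = (\<Sum>n<k. indicator {\<omega> \<in> space M. N \<omega> = enat n} \<omega> * s ^ n)" for k \<omega>
  have partial: "g k \<omega> = (if N \<omega> < enat k then enat_power s (N \<omega>) else 0)" if "\<omega> \<in> space M" for k \<omega>
  proof (cases "N \<omega>")
    case (enat m)
    have "g k \<omega> = (\<Sum>n<k. if n = m then s ^ n else 0)"
      unfolding g_def using enat that by (intro sum.cong) auto
    then show ?thesis using enat by (simp add: enat_power_def)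
  qed (use s in \<open>simp add: g_def enat_power_def\<close>)
  have "(\<lambda>k. expectation (g k)) \<longlonglongrightarrow> expectation (\<lambda>\<omega>. enat_power s (N \<omega>))"
  proof (rule integral_dominated_convergence[where w = "\<lambda>_. 1"])
    show "g k \<in> borel_measurable M" for k unfolding g_def by measurable
    show "AE \<omega> in M. (\<lambda>k. g k \<omega>) \<longlonglongrightarrow> enat_power s (N \<omega>)"
    proof (rule AE_I2)
      fix \<omega> assume \<omega>: "\<omega> \<in> space M"
      show "(\<lambda>k. g k \<omega>) \<longlonglongrightarrow> enat_power s (N \<omega>)"
      proof (cases "N \<omega>")
        case (enat m)
        have "\<forall>\<^sub>F k in sequentially. g k \<omega> = enat_power s (N \<omega>)"
          using eventually_gt_at_top[of m] by eventually_elim (simp add: partial[OF \<omega>] enat)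
        then show ?thesis by (rule tendsto_eventually)
      qed (use s in \<open>simp add: partial[OF \<omega>] enat_power_def\<close>)
    qed
    show "AE \<omega> in M. norm (g k \<omega>) \<le> 1" for k
      using s by (intro AE_I2)
        (auto simp: partial enat_power_def power_le_one split: enat.split)
    have "enat_power s \<in> borel_measurable (count_space UNIV)" by simp
    then show "(\<lambda>\<omega>. enat_power s (N \<omega>)) \<in> borel_measurable M"
      by measurable
  qed simp
  moreover have "expectation (g k) = (\<Sum>n<k. prob {\<omega> \<in> space M. N \<omega> = enat n} * s ^ n)" for k
  proof -
    have "integrable M (\<lambda>\<omega>. indicator {\<omega> \<in> space M. N \<omega> = enat n} \<omega> * s ^ n)" for n
      by (intro integrable_mult_left integrable_real_indicator) (auto simp: emeasure_eq_measure)
    then show ?thesis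
      unfolding g_def by (subst Bochner_Integration.integral_sum) auto
  qed
  ultimately show ?thesis by (simp add: sums_def)
qed

lemma expectation_enat_power_poisson:
  assumes N: "poisson_distributed M N r" and r: "0 \<le> r" and s: "0 \<le> s" "s \<le> 1"
  shows "expectation (\<lambda>\<omega>. enat_power s (N \<omega>)) = exp (- r * (1 - s))"
proof (cases "s = 1")
  case True
  then have "enat_power s n = 1" for n by (simp add: enat_power_def split: enat.split)
  then show ?thesis using True by (simp add: prob_space)
next
  case False
  have N_meas: "N \<in> measurable M (count_space UNIV)"
    and N_distr: "distr M (count_space UNIV) N = measure_pmf (poisson_law r)"
    using N by (auto simp: poisson_distributed_def)
  have "prob {\<omega> \<in> space M. N \<omega> = enat n} = r ^ n / fact n * exp (- r)" for n
  proof -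
    have "prob {\<omega> \<in> space M. N \<omega> = enat n} = measure (distr M (count_space UNIV) N) {enat n}"
      by (subst measure_distr[OF N_meas]) (auto intro!: arg_cong[where f = prob])
    then show ?thesis
      by (simp add: N_distr measure_pmf_single pmf_poisson_law_enat[OF r])
  qed
  then have "(\<lambda>n. r ^ n / fact n * exp (- r) * s ^ n) sums expectation (\<lambda>\<omega>. enat_power s (N \<omega>))"
    using enat_power_expectation_sums[OF N_meas, of s] s False by simp
  moreover have "(\<lambda>n. exp (- r) * ((r * s) ^ n /\<^sub>R fact n)) sums (exp (- r) * exp (r * s))"
    by (intro sums_mult exp_converges)
  ultimately have "expectation (\<lambda>\<omega>. enat_power s (N \<omega>)) = exp (- r) * exp (r * s)"
    by (intro sums_unique2) (simp_all add: field_simps power_mult_distrib)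
  then show ?thesis by (simp add: exp_add[symmetric] algebra_simps)
qed

text \<open>
  The generating function determines the probabilities of all finite values. They are those of the
  Poisson law, so they already sum to \<open>1\<close> and nothing is left for the value \<open>\<infinity>\<close>.
\<close>

lemma poisson_distributedI_pgf:
  assumes N: "N \<in> measurable M (count_space UNIV)" and r: "0 \<le> r"
    and pgf: "\<And>s. 0 < s \<Longrightarrow> s < 1 \<Longrightarrow> expectation (\<lambda>\<omega>. enat_power s (N \<omega>)) = exp (- r * (1 - s))"
  shows "poisson_distributed M N r"
proof -
  let ?p = "\<lambda>n. prob {\<omega> \<in> space M. N \<omega> = enat n}"
  have "?p n - r ^ n / fact n * exp (- r) = 0" for n
  proof (rule powser_eq_0_right_imp_coeff_eq_0)
    fix s :: real assume s: "0 < s" "s < 1"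
    have "(\<lambda>n. ?p n * s ^ n) sums (exp (- r) * exp (r * s))"
      using enat_power_expectation_sums[OF N, of s] s
      by (simp add: pgf exp_add[symmetric] algebra_simps)
    moreover have "(\<lambda>n. exp (- r) * ((r * s) ^ n /\<^sub>R fact n)) sums (exp (- r) * exp (r * s))"
      by (intro sums_mult exp_converges)
    ultimately have "(\<lambda>n. ?p n * s ^ n - exp (- r) * ((r * s) ^ n /\<^sub>R fact n)) sums
        (exp (- r) * exp (r * s) - exp (- r) * exp (r * s))"
      by (rule sums_diff)
    then show "(\<lambda>n. (?p n - r ^ n / fact n * exp (- r)) * s ^ n) sums 0"
      by (simp add: field_simps power_mult_distrib)
  qed
  then have p: "?p n = r ^ n / fact n * exp (- r)" for n
    by simp
  let ?D = "distr M (count_space UNIV) N"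
  interpret D: prob_space ?D
    by (rule prob_space_distr[OF N])
  have fin: "emeasure ?D {enat n} = emeasure (measure_pmf (poisson_law r)) {enat n}" for n
  proof -
    have "measure ?D {enat n} = ?p n"
      by (subst measure_distr[OF N]) (auto intro!: arg_cong[where f = prob])
    then show ?thesis
      by (simp add: D.emeasure_eq_measure emeasure_pmf_single pmf_poisson_law_enat[OF r] p)
  qed
  have "?D = measure_pmf (poisson_law r)"
  proof (rule measure_eqI_countable_AE[where \<Omega> = "range enat"])
    show "AE x in measure_pmf (poisson_law r). x \<in> range enat"
      by (auto simp: AE_measure_pmf_iff poisson_law_def)
    have "emeasure ?D (range enat) = (\<integral>\<^sup>+ x. emeasure ?D {x} \<partial>count_space (range enat))"
      by (rule emeasure_countable_singleton) auto
    also have "\<dots> = (\<integral>\<^sup>+ x. emeasure (measure_pmf (poisson_law r)) {x} \<partial>count_space (range enat))"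
      by (rule nn_integral_cong) (auto simp: fin)
    also have "\<dots> = emeasure (measure_pmf (poisson_law r)) (range enat)"
      by (rule emeasure_countable_singleton[symmetric]) auto
    also have "\<dots> = 1"
      by (subst measure_pmf.emeasure_eq_1_AE) (auto simp: AE_measure_pmf_iff poisson_law_def)
    \<comment> \<open>the finite values carry the full mass of the Poisson law, hence that of \<open>N\<close>\<close>
    finally show "AE x in ?D. x \<in> range enat"
      by (intro D.AE_in_set_eq_1[THEN iffD2]) (auto simp: D.emeasure_eq_measure)
  qed (auto simp: fin)
  then show ?thesis using N by (simp add: poisson_distributed_def)
qed


lemma AE_poisson_distributed_finite:
  assumes "poisson_distributed M N r"
  shows "AE \<omega> in M. N \<omega> \<noteq> \<infinity>"
proof -
  have N: "N \<in> measurable M (count_space UNIV)"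
    and D: "distr M (count_space UNIV) N = measure_pmf (poisson_law r)"
    using assms by (auto simp: poisson_distributed_def)
  have "AE n in distr M (count_space UNIV) N. n \<noteq> \<infinity>"
    unfolding D by (auto simp: AE_measure_pmf_iff poisson_law_def)
  then show ?thesis
    using N by (subst (asm) AE_distr_iff) auto
qed

lemma prob_poisson_distributed_eq_0:
  assumes "poisson_distributed M N r" "0 \<le> r"
  shows "prob {\<omega> \<in> space M. N \<omega> = 0} = exp (- r)"
proof -
  have N: "N \<in> measurable M (count_space UNIV)"
    and D: "distr M (count_space UNIV) N = measure_pmf (poisson_law r)"
    using assms by (auto simp: poisson_distributed_def)
  have "prob {\<omega> \<in> space M. N \<omega> = 0} = measure (distr M (count_space UNIV) N) {enat 0}"
    by (subst measure_distr[OF N]) (auto simp: zero_enat_def intro!: arg_cong[where f = prob])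
  then show ?thesis
    by (simp add: D measure_pmf_single pmf_poisson_law_enat[OF assms(2)])
qed

section \<open>Integrating out independent marks\<close>

text \<open>
  Positions and marks may have different types, so their independence is expressed through the
  sigma-algebras that they generate.
\<close>

lemma distr_Pair_eq_pair_measure:
  assumes Y[measurable]: "Y \<in> measurable M A" and Z[measurable]: "Z \<in> measurable M S"
    and indep: "indep_set (sets (vimage_algebra (space M) Y A)) (sets (vimage_algebra (space M) Z S))"
  shows "distr M A Y \<Otimes>\<^sub>M distr M S Z = distr M (A \<Otimes>\<^sub>M S) (\<lambda>\<omega>. (Y \<omega>, Z \<omega>))"
proof (rule pair_measure_eqI)
  show "sigma_finite_measure (distr M A Y)" "sigma_finite_measure (distr M S Z)"
    by (auto intro!: prob_space_imp_sigma_finite prob_space_distr)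
  fix B C assume "B \<in> sets (distr M A Y)" "C \<in> sets (distr M S Z)"
  then have BC[measurable]: "B \<in> sets A" "C \<in> sets S" by auto
  have "prob ((Y -` B \<inter> space M) \<inter> (Z -` C \<inter> space M)) = prob (Y -` B \<inter> space M) * prob (Z -` C \<inter> space M)"
    using BC by (intro indep_setD[OF indep] in_vimage_algebra)
  moreover have "(\<lambda>\<omega>. (Y \<omega>, Z \<omega>)) -` (B \<times> C) \<inter> space M = (Y -` B \<inter> space M) \<inter> (Z -` C \<inter> space M)"
    by auto
  ultimately show "emeasure (distr M A Y) B * emeasure (distr M S Z) C =
      emeasure (distr M (A \<Otimes>\<^sub>M S) (\<lambda>\<omega>. (Y \<omega>, Z \<omega>))) (B \<times> C)"
    by (simp add: emeasure_distr emeasure_eq_measure ennreal_mult'[symmetric])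
qed simp

text \<open>
  Fubini for the joint law of positions and marks: with the positions \<open>\<eta>\<close> fixed, the factors are
  independent, and the one of a point at \<open>\<eta> i\<close> has mean \<open>s * q + (1 - q)\<close>, where \<open>q\<close> is the
  probability that its mark puts it into \<open>K\<close>.
\<close>

lemma expectation_prod_thinning:
  fixes y :: "nat \<Rightarrow> 'a \<Rightarrow> 'b" and h :: "nat \<Rightarrow> 'a \<Rightarrow> 'c"
  assumes yh: "indep_set (sets (vimage_algebra (space M) (\<lambda>\<omega> i. y i \<omega>) (\<Pi>\<^sub>M i\<in>UNIV. A)))
      (sets (vimage_algebra (space M) (\<lambda>\<omega> i. h i \<omega>) (\<Pi>\<^sub>M i\<in>UNIV. S)))"
    and y: "\<And>i. y i \<in> measurable M A" and h: "indep_vars (\<lambda>_. S) h UNIV" "\<And>i. distr M S (h i) = \<nu>"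
    and K: "K \<in> sets (A \<Otimes>\<^sub>M S)" and s: "0 \<le> s" "s \<le> 1"
  shows "expectation (\<lambda>\<omega>. \<Prod>i<k. if (y i \<omega>, h i \<omega>) \<in> K then s else 1) =
    expectation (\<lambda>\<omega>. \<Prod>i<k. 1 - (1 - s) * measure \<nu> {w \<in> space S. (y i \<omega>, w) \<in> K})"
proof -
  note K[measurable]
  define A' where "A' = (\<Pi>\<^sub>M i\<in>(UNIV :: nat set). A)"
  define S' where "S' = (\<Pi>\<^sub>M i\<in>(UNIV :: nat set). S)"
  define Y where "Y = (\<lambda>\<omega> i. y i \<omega>)"
  define Z where "Z = (\<lambda>\<omega> i. h i \<omega>)"
  define G where "G = (\<lambda>(\<eta>, \<zeta>). \<Prod>i<k. if (\<eta> i :: 'b, \<zeta> i :: 'c) \<in> K then s else 1)"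
  have h_meas[measurable]: "h i \<in> measurable M S" for i
    using h(1) by (auto simp: indep_vars_def)
  note y[measurable]
  have Y[measurable]: "Y \<in> measurable M A'" and Z[measurable]: "Z \<in> measurable M S'"
    unfolding A'_def S'_def Y_def Z_def by (auto intro!: measurable_PiM_single' simp: measurable_space[OF y] measurable_space[OF h_meas])
  have joint: "distr M A' Y \<Otimes>\<^sub>M distr M S' Z = distr M (A' \<Otimes>\<^sub>M S') (\<lambda>\<omega>. (Y \<omega>, Z \<omega>))"
    using yh unfolding A'_def[symmetric] S'_def[symmetric] Y_def[symmetric] Z_def[symmetric]
    by (rule distr_Pair_eq_pair_measure[OF Y Z])
  have G_meas[measurable]: "G \<in> borel_measurable (A' \<Otimes>\<^sub>M S')"
    unfolding G_def A'_def S'_def by measurable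
  have G_bound: "\<bar>G p\<bar> \<le> 1" for p
    using s by (auto simp: G_def split_beta abs_prod intro!: prod_le_1)
  interpret Y: prob_space "distr M A' Y" by (rule prob_space_distr) simp
  interpret Z: prob_space "distr M S' Z" by (rule prob_space_distr) simp
  interpret YZ: pair_prob_space "distr M A' Y" "distr M S' Z" ..
  have inner: "(\<integral>\<zeta>. G (\<eta>, \<zeta>) \<partial>distr M S' Z) =
      (\<Prod>i<k. 1 - (1 - s) * measure \<nu> {w \<in> space S. (\<eta> i, w) \<in> K})"
    if \<eta>: "\<eta> \<in> space A'" for \<eta>
  proof -
    have [measurable]: "\<eta> i \<in> space A" for i
      using \<eta> by (auto simp: A'_def space_PiM)
    have "(\<integral>\<zeta>. G (\<eta>, \<zeta>) \<partial>distr M S' Z) = expectation (\<lambda>\<omega>. G (\<eta>, Z \<omega>))"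
      using \<eta> by (intro integral_distr) measurable
    also have "\<dots> = expectation (\<lambda>\<omega>. \<Prod>i<k. if (\<eta> i, h i \<omega>) \<in> K then s else 1)"
      by (simp add: G_def Z_def)
    also have "\<dots> = (\<Prod>i<k. expectation (\<lambda>\<omega>. if (\<eta> i, h i \<omega>) \<in> K then s else 1))"
    proof (rule indep_vars_lebesgue_integral)
      have "indep_vars (\<lambda>_. S) h {..<k}"
        by (rule indep_vars_subset[OF h(1)]) simp
      then show "indep_vars (\<lambda>_. borel) (\<lambda>i \<omega>. if (\<eta> i, h i \<omega>) \<in> K then s else 1) {..<k}"
        by (rule indep_vars_compose2) measurable
      show "integrable M (\<lambda>\<omega>. if (\<eta> i, h i \<omega>) \<in> K then s else 1)" for i
        using s by (intro integrable_const_bound[where B = 1]) auto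
    qed simp
    also have "\<dots> = (\<Prod>i<k. 1 - (1 - s) * measure \<nu> {w \<in> space S. (\<eta> i, w) \<in> K})"
    proof (intro prod.cong refl)
      fix i
      have "expectation (\<lambda>\<omega>. if (\<eta> i, h i \<omega>) \<in> K then s else 1) =
          expectation (\<lambda>\<omega>. 1 - (1 - s) * indicator {\<omega> \<in> space M. (\<eta> i, h i \<omega>) \<in> K} \<omega>)"
        by (intro Bochner_Integration.integral_cong) auto
      also have "\<dots> = 1 - (1 - s) * prob {\<omega> \<in> space M. (\<eta> i, h i \<omega>) \<in> K}"
        by (subst Bochner_Integration.integral_diff) (auto simp: prob_space emeasure_eq_measure)
      also have "prob {\<omega> \<in> space M. (\<eta> i, h i \<omega>) \<in> K} = measure (distr M S (h i)) {w \<in> space S. (\<eta> i, w) \<in> K}"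
        by (subst measure_distr) (auto intro!: arg_cong[where f = prob] dest: measurable_space[OF h_meas])
      finally show "expectation (\<lambda>\<omega>. if (\<eta> i, h i \<omega>) \<in> K then s else 1) =
          1 - (1 - s) * measure \<nu> {w \<in> space S. (\<eta> i, w) \<in> K}"
        by (simp add: h(2))
    qed
    finally show ?thesis .
  qed
  have "expectation (\<lambda>\<omega>. \<Prod>i<k. if (y i \<omega>, h i \<omega>) \<in> K then s else 1) =
      integral\<^sup>L (distr M (A' \<Otimes>\<^sub>M S') (\<lambda>\<omega>. (Y \<omega>, Z \<omega>))) G"
  proof -
    have "integral\<^sup>L (distr M (A' \<Otimes>\<^sub>M S') (\<lambda>\<omega>. (Y \<omega>, Z \<omega>))) G = expectation (\<lambda>\<omega>. G (Y \<omega>, Z \<omega>))"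
      by (intro integral_distr) measurable
    then show ?thesis by (simp add: G_def Y_def Z_def)
  qed
  also have "\<dots> = integral\<^sup>L (distr M A' Y \<Otimes>\<^sub>M distr M S' Z) G"
    by (simp add: joint)
  also have "\<dots> = (\<integral>\<eta>. (\<integral>\<zeta>. G (\<eta>, \<zeta>) \<partial>distr M S' Z) \<partial>distr M A' Y)"
    by (intro YZ.integral_fst'[symmetric] YZ.P.integrable_const_bound[where B = 1])
      (simp_all add: G_bound)
  also have "\<dots> = expectation (\<lambda>\<omega>. \<integral>\<zeta>. G (Y \<omega>, \<zeta>) \<partial>distr M S' Z)"
    by (intro integral_distr) measurable
  also have "\<dots> = expectation (\<lambda>\<omega>. \<Prod>i<k. 1 - (1 - s) * measure \<nu> {w \<in> space S. (y i \<omega>, w) \<in> K})"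
    using measurable_space[OF Y]
    by (intro Bochner_Integration.integral_cong) (simp_all add: inner Y_def)
  finally show ?thesis .
qed

section \<open>The generating functional of a Poisson process\<close>

text \<open>
  If \<open>f\<close> takes the value \<open>e j\<close> on \<open>E j\<close>, the product of \<open>1 - f\<close> over all points is the product over
  \<open>j\<close> of \<open>1 - e j\<close> raised to the number of points in \<open>E j\<close>. These numbers are independent and Poisson,
  so the expectation factorises into values of Poisson generating functions.
\<close>

lemma poisson_process_pgfl_simple:
  fixes y :: "nat \<Rightarrow> 'a \<Rightarrow> 'b::euclidean_space" and f :: "'b \<Rightarrow> real"
  assumes y: "homogeneous_poisson_process M \<mu> y" and \<mu>: "0 \<le> \<mu>"
    and f: "simple_function borel f" "integrable lborel f" and f01: "\<And>z. 0 \<le> f z" "\<And>z. f z \<le> 1"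
  shows "(\<lambda>k. expectation (\<lambda>\<omega>. \<Prod>i<k. 1 - f (y i \<omega>))) \<longlonglongrightarrow> exp (- \<mu> * integral\<^sup>L lborel f)"
proof -
  define R where "R = range f - {0}"
  have R: "finite R"
    using f(1) by (auto simp: R_def simple_function_def)
  obtain e :: "nat \<Rightarrow> real" and n where e: "bij_betw e {..<n} R"
    using ex_bij_betw_nat_finite[OF R] by (auto simp: atLeast0LessThan)
  define E where "E j = f -` {e j}" for j
  have f_meas[measurable]: "f \<in> borel_measurable borel"
    using f(1) by (rule borel_measurable_simple_function)
  have e_R: "e j \<in> R" if "j < n" for j
    using e that by (auto simp: bij_betw_def)
  have e01: "0 < e j" "e j \<le> 1" if "j < n" for j
    using e_R[OF that] f01 by (auto simp: R_def less_le)
  have E_sets[measurable]: "E j \<in> sets borel" for j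
    using measurable_sets[OF f_meas, of "{e j}"] by (simp add: E_def)
  \<comment> \<open>counts are known to be Poisson and independent only on sets of finite volume, hence the
    restriction to the nonzero values of \<open>f\<close>\<close>
  have E_fin: "emeasure lborel (E j) < \<infinity>" if "j < n" for j
  proof -
    have "emeasure lborel (E j) \<le> emeasure lborel {z \<in> space lborel. e j \<le> f z}"
      by (intro emeasure_mono) (auto simp: E_def)
    also have "\<dots> \<le> ennreal ((1 / e j) * (\<integral>z. f z \<partial>lborel))"
      using f01 e01[OF that] by (intro integral_Markov_inequality f) auto
    also have "\<dots> < \<infinity>" by simp
    finally show ?thesis .
  qed
  have E_disj: "disjoint_family_on E {..<n}"
    using e by (auto simp: disjoint_family_on_def E_def bij_betw_def inj_on_def)
  have count: "poisson_distributed M (point_count y (E j)) (\<mu> * measure lborel (E j))" if "j < n" for j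
    using y E_fin[OF that] E_sets[of j] by (auto simp: homogeneous_poisson_process_def)
  have count_meas: "point_count y (E j) \<in> measurable M (count_space UNIV)" if "j < n" for j
    using count[OF that] by (simp add: poisson_distributed_def)
  have power_meas: "(\<lambda>\<omega>. enat_power s (point_count y (E j) \<omega>)) \<in> borel_measurable M" if "j < n" for s j
    by (rule measurable_compose[OF count_meas[OF that]]) simp
  have indep: "indep_vars (\<lambda>_. count_space UNIV) (\<lambda>j. point_count y (E j)) {..<n}"
    using y E_disj E_fin unfolding homogeneous_poisson_process_def by auto
  have factor: "1 - f z = (\<Prod>j<n. if z \<in> E j then 1 - e j else 1)" for z
  proof -
    have "(\<Prod>j<n. if z \<in> E j then 1 - e j else 1) = (\<Prod>j<n. if f z = e j then 1 - e j else 1)"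
      by (intro prod.cong) (auto simp: E_def)
    also have "\<dots> = (\<Prod>v\<in>R. if f z = v then 1 - v else 1)"
      by (rule prod.reindex_bij_betw[OF e])
    finally show ?thesis using R by (auto simp: R_def)
  qed
  have lim: "(\<lambda>k. \<Prod>i<k. 1 - f (y i \<omega>)) \<longlonglongrightarrow> (\<Prod>j<n. enat_power (1 - e j) (point_count y (E j) \<omega>))" for \<omega>
  proof -
    have "(\<lambda>k. \<Prod>j<n. \<Prod>i<k. if y i \<omega> \<in> E j then 1 - e j else 1) \<longlonglongrightarrow>
        (\<Prod>j<n. enat_power (1 - e j) (point_count y (E j) \<omega>))"
      unfolding point_count_def using e01 by (intro tendsto_prod prod_if_tendsto_enat_power) (auto simp: less_imp_le)
    then show ?thesis by (simp add: factor prod.swap[of _ "{..<n}"])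
  qed
  have y_meas[measurable]: "y i \<in> borel_measurable M" for i
    using y by (simp add: homogeneous_poisson_process_def)
  have "(\<lambda>k. expectation (\<lambda>\<omega>. \<Prod>i<k. 1 - f (y i \<omega>))) \<longlonglongrightarrow>
      expectation (\<lambda>\<omega>. \<Prod>j<n. enat_power (1 - e j) (point_count y (E j) \<omega>))"
  proof (rule integral_dominated_convergence[where w = "\<lambda>_. 1"])
    show "AE \<omega> in M. norm (\<Prod>i<k. 1 - f (y i \<omega>)) \<le> 1" for k
      using f01 by (intro AE_I2) (auto simp: abs_prod intro!: prod_le_1)
    show "(\<lambda>\<omega>. \<Prod>j<n. enat_power (1 - e j) (point_count y (E j) \<omega>)) \<in> borel_measurable M"
      by (intro borel_measurable_prod power_meas) simp
  qed (simp_all add: lim)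
  also have "expectation (\<lambda>\<omega>. \<Prod>j<n. enat_power (1 - e j) (point_count y (E j) \<omega>)) =
      (\<Prod>j<n. expectation (\<lambda>\<omega>. enat_power (1 - e j) (point_count y (E j) \<omega>)))"
  proof (rule indep_vars_lebesgue_integral)
    show "finite {..<n}" by simp
    show "indep_vars (\<lambda>_. borel) (\<lambda>j \<omega>. enat_power (1 - e j) (point_count y (E j) \<omega>)) {..<n}"
      using indep by (rule indep_vars_compose2) simp
    show "integrable M (\<lambda>\<omega>. enat_power (1 - e j) (point_count y (E j) \<omega>))" if "j \<in> {..<n}" for j
      using that e01 power_meas
      by (intro integrable_const_bound[where B = 1])
        (auto simp: less_imp_le intro!: abs_enat_power_le_1)
  qed
  also have "\<dots> = (\<Prod>j<n. exp (- (\<mu> * measure lborel (E j)) * e j))"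
  proof (intro prod.cong refl)
    fix j assume "j \<in> {..<n}"
    then have v: "j < n" by simp
    show "expectation (\<lambda>\<omega>. enat_power (1 - e j) (point_count y (E j) \<omega>)) = exp (- (\<mu> * measure lborel (E j)) * e j)"
      using expectation_enat_power_poisson[OF count[OF v], of "1 - e j"] \<mu> e01[OF v] by simp
  qed
  also have "\<dots> = exp (- \<mu> * (\<Sum>j<n. e j * measure lborel (E j)))"
    by (simp add: exp_sum[symmetric] sum_distrib_left sum_negf algebra_simps)
  also have "(\<Sum>j<n. e j * measure lborel (E j)) = integral\<^sup>L lborel f"
  proof -
    have "f z = (\<Sum>j<n. e j * indicator (E j) z)" for z
    proof -
      have "(\<Sum>j<n. e j * indicator (E j) z) = (\<Sum>j<n. if f z = e j then e j else 0)"
        by (intro sum.cong) (auto simp: E_def)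
      also have "\<dots> = (\<Sum>v\<in>R. if f z = v then v else 0)"
        by (rule sum.reindex_bij_betw[OF e])
      finally show ?thesis using R by (auto simp: R_def)
    qed
    then have "integral\<^sup>L lborel f = (\<integral>z. (\<Sum>j<n. e j * indicator (E j) z) \<partial>lborel)"
      by (intro Bochner_Integration.integral_cong) auto
    also have "\<dots> = (\<Sum>j<n. e j * measure lborel (E j))"
      using E_fin by (subst Bochner_Integration.integral_sum) auto
    finally show ?thesis by simp
  qed
  finally show ?thesis .
qed

text \<open>
  Approximation from below by simple functions \<open>g n\<close>. Two limits, in \<open>n\<close> and in the number \<open>k\<close> of
  factors, have to be interchanged. Monotonicity suffices for that: the finite products decrease in
  \<open>k\<close> and in the function, so they are never below \<open>exp (- \<mu> * \<integral> f)\<close>, and for large \<open>k\<close> those of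
  \<open>g n\<close> push them down to \<open>exp (- \<mu> * \<integral> g n)\<close>.
\<close>

lemma poisson_process_pgfl:
  fixes y :: "nat \<Rightarrow> 'a \<Rightarrow> 'b::euclidean_space" and f :: "'b \<Rightarrow> real"
  assumes y: "homogeneous_poisson_process M \<mu> y" and \<mu>: "0 \<le> \<mu>"
    and f: "integrable lborel f" and f01: "\<And>z. 0 \<le> f z" "\<And>z. f z \<le> 1"
  shows "(\<lambda>k. expectation (\<lambda>\<omega>. \<Prod>i<k. 1 - f (y i \<omega>))) \<longlonglongrightarrow> exp (- \<mu> * integral\<^sup>L lborel f)"
    (is "?E f \<longlonglongrightarrow> ?e f")
proof -
  have y_meas[measurable]: "y i \<in> borel_measurable M" for i
    using y by (simp add: homogeneous_poisson_process_def)
  have f_meas[measurable]: "f \<in> borel_measurable borel"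
    using f by (auto dest: borel_measurable_integrable)
  obtain g where g: "incseq g" "\<And>n. simple_function borel (g n)"
      "\<And>z. bdd_above (range (\<lambda>n. g n z))" "\<And>n z. 0 \<le> g n z" "f = (SUP n. g n)"
    using borel_measurable_implies_simple_function_sequence_real[OF f_meas f01(1)] by blast
  have f_SUP: "f z = (SUP n. g n z)" for z
    by (simp add: g(5) SUP_apply image_image)
  have g_le: "g n z \<le> f z" for n z
    unfolding f_SUP by (rule cSUP_upper[OF _ g(3)]) simp
  have g_lim: "(\<lambda>n. g n z) \<longlonglongrightarrow> f z" for z
    unfolding f_SUP using g(1) by (intro LIMSEQ_incseq_SUP g(3)) (auto simp: incseq_def le_fun_def)
  have g_meas[measurable]: "g n \<in> borel_measurable borel" for n
    using g(2) by (rule borel_measurable_simple_function)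
  have g1: "g n z \<le> 1" for n z
    using g_le f01(2) order_trans by blast
  have g_int: "integrable lborel (g n)" for n
    using g(4) g_le f01 by (intro Bochner_Integration.integrable_bound[OF f]) auto
  have E_simple: "?E (g n) \<longlonglongrightarrow> ?e (g n)" for n
    by (rule poisson_process_pgfl_simple[OF y \<mu> g(2) g_int g(4) g1])
  have integrable_prod: "integrable M (\<lambda>\<omega>. \<Prod>i<k. 1 - u (y i \<omega>))"
    if "u \<in> borel_measurable borel" "\<And>z. 0 \<le> u z" "\<And>z. u z \<le> 1" for u :: "'b \<Rightarrow> real" and k
    using that by (intro integrable_const_bound[where B = 1]) (auto simp: abs_prod intro!: prod_le_1)
  have E_mono: "?E v k \<le> ?E u k"
    if "u \<in> borel_measurable borel" "v \<in> borel_measurable borel"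
      "\<And>z. 0 \<le> u z" "\<And>z. u z \<le> v z" "\<And>z. v z \<le> 1" for u v :: "'b \<Rightarrow> real" and k
    using that by (intro integral_mono integrable_prod prod_mono) (auto intro: order_trans)
  have E_decseq: "decseq (?E u)"
    if "u \<in> borel_measurable borel" "\<And>z. 0 \<le> u z" "\<And>z. u z \<le> 1" for u :: "'b \<Rightarrow> real"
    using that by (intro decseq_SucI integral_mono integrable_prod)
      (auto intro!: mult_right_le_one_le prod_nonneg)
  have lower: "?e f \<le> ?E f k" for k
  proof (rule LIMSEQ_le_const)
    show "(\<lambda>n. ?E (g n) k) \<longlonglongrightarrow> ?E f k"
    proof (rule integral_dominated_convergence[where w = "\<lambda>_. 1"])
      show "AE \<omega> in M. norm (\<Prod>i<k. 1 - g n (y i \<omega>)) \<le> 1" for n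
        using g(4) g1 by (intro AE_I2) (auto simp: abs_prod intro!: prod_le_1)
      show "AE \<omega> in M. (\<lambda>n. \<Prod>i<k. 1 - g n (y i \<omega>)) \<longlonglongrightarrow> (\<Prod>i<k. 1 - f (y i \<omega>))"
        by (intro AE_I2 tendsto_intros g_lim)
    qed simp_all
    have "?e f \<le> ?E (g n) k" for n
    proof -
      have "integral\<^sup>L lborel (g n) \<le> integral\<^sup>L lborel f"
        by (intro integral_mono g_int f g_le)
      then have "?e f \<le> ?e (g n)"
        using \<mu> by (simp add: mult_left_mono)
      also have "\<dots> \<le> ?E (g n) k"
        by (rule decseq_ge[OF E_decseq E_simple]) (simp_all add: g(4) g1)
      finally show ?thesis .
    qed
    then show "\<exists>N. \<forall>n\<ge>N. ?e f \<le> ?E (g n) k" by blast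
  qed
  have e_lim: "(\<lambda>n. ?e (g n)) \<longlonglongrightarrow> ?e f"
  proof (intro tendsto_intros)
    show "(\<lambda>n. integral\<^sup>L lborel (g n)) \<longlonglongrightarrow> integral\<^sup>L lborel f"
      using g(4) g_le f01 by (intro integral_dominated_convergence[OF _ _ f] AE_I2 g_lim) simp_all
  qed
  show ?thesis
  proof (rule order_tendstoI)
    fix c assume "c < ?e f"
    then show "\<forall>\<^sub>F k in sequentially. c < ?E f k"
      using lower by (intro always_eventually allI) (rule less_le_trans)
  next
    fix c assume "?e f < c"
    then obtain n where "?e (g n) < c"
      using order_tendstoD(2)[OF e_lim] by (auto simp: eventually_sequentially)
    then have "\<forall>\<^sub>F k in sequentially. ?E (g n) k < c"
      using order_tendstoD(2)[OF E_simple] by blast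
    moreover have "?E f k \<le> ?E (g n) k" for k
      by (rule E_mono) (simp_all add: g(4) g_le f01)
    ultimately show "\<forall>\<^sub>F k in sequentially. ?E f k < c"
      by (auto elim!: eventually_mono intro: le_less_trans)
  qed
qed

section \<open>Marked Poisson processes\<close>

text \<open>
  Marking theorem, for the count of a single set \<open>K\<close>. Averaging over the marks turns the generating
  function of the count into the generating functional of the positions, evaluated at \<open>(1 - s) * q\<close>.
\<close>

theorem marked_poisson_process_count:
  fixes y :: "nat \<Rightarrow> 'a \<Rightarrow> 'b::euclidean_space" and h :: "nat \<Rightarrow> 'a \<Rightarrow> 'c"
  assumes y: "homogeneous_poisson_process M \<mu> y" and \<mu>: "0 \<le> \<mu>"
    and yh: "indep_set (sets (vimage_algebra (space M) (\<lambda>\<omega> i. y i \<omega>) (\<Pi>\<^sub>M i\<in>UNIV. borel)))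
      (sets (vimage_algebra (space M) (\<lambda>\<omega> i. h i \<omega>) (\<Pi>\<^sub>M i\<in>UNIV. S)))"
    and h: "indep_vars (\<lambda>_. S) h UNIV" "\<And>i. distr M S (h i) = \<nu>"
    and K: "K \<in> sets (borel \<Otimes>\<^sub>M S)"
    and q: "integrable lborel (\<lambda>z. measure \<nu> {w \<in> space S. (z, w) \<in> K})"
  shows "poisson_distributed M (\<lambda>\<omega>. ecard {i. (y i \<omega>, h i \<omega>) \<in> K})
    (\<mu> * (\<integral>z. measure \<nu> {w \<in> space S. (z, w) \<in> K} \<partial>lborel))"
    (is "poisson_distributed M ?N (\<mu> * integral\<^sup>L lborel ?q)")
proof (rule poisson_distributedI_pgf)
  note K[measurable]
  have y_meas[measurable]: "y i \<in> borel_measurable M" for i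
    using y by (simp add: homogeneous_poisson_process_def)
  have h_meas[measurable]: "h i \<in> measurable M S" for i
    using h(1) by (auto simp: indep_vars_def)
  have pair_meas: "Measurable.pred M (\<lambda>\<omega>. (y i \<omega>, h i \<omega>) \<in> K)" for i
    by measurable
  then show N_meas: "?N \<in> measurable M (count_space UNIV)"
    by (rule measurable_ecard_Collect)
  show "0 \<le> \<mu> * integral\<^sup>L lborel ?q"
    using \<mu> by simp
  interpret \<nu>: prob_space \<nu>
    unfolding h(2)[of 0, symmetric] by (rule prob_space_distr) simp
  fix s :: real assume s: "0 < s" "s < 1"
  have "(\<lambda>k. expectation (\<lambda>\<omega>. \<Prod>i<k. if (y i \<omega>, h i \<omega>) \<in> K then s else 1)) \<longlonglongrightarrow>
      expectation (\<lambda>\<omega>. enat_power s (?N \<omega>))"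
  proof (rule integral_dominated_convergence[where w = "\<lambda>_. 1"])
    show "(\<lambda>\<omega>. enat_power s (?N \<omega>)) \<in> borel_measurable M"
      by (rule measurable_compose[OF N_meas]) simp
    show "AE \<omega> in M. (\<lambda>k. \<Prod>i<k. if (y i \<omega>, h i \<omega>) \<in> K then s else 1) \<longlonglongrightarrow> enat_power s (?N \<omega>)"
      using s by (intro AE_I2 prod_if_tendsto_enat_power) auto
    show "AE \<omega> in M. norm (\<Prod>i<k. if (y i \<omega>, h i \<omega>) \<in> K then s else 1) \<le> 1" for k
      using s by (intro AE_I2) (auto simp: abs_prod intro!: prod_le_1)
  qed (use pair_meas in \<open>simp_all\<close>)
  moreover have "(\<lambda>k. expectation (\<lambda>\<omega>. \<Prod>i<k. if (y i \<omega>, h i \<omega>) \<in> K then s else 1)) \<longlonglongrightarrow>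
      exp (- \<mu> * (\<integral>z. (1 - s) * ?q z \<partial>lborel))"
    using s unfolding expectation_prod_thinning[OF yh y_meas h K less_imp_le[OF s(1)] less_imp_le[OF s(2)]]
    by (intro poisson_process_pgfl[OF y \<mu>] integrable_mult_right q) (auto intro!: mult_le_one)
  ultimately have "expectation (\<lambda>\<omega>. enat_power s (?N \<omega>)) = exp (- \<mu> * (\<integral>z. (1 - s) * ?q z \<partial>lborel))"
    by (rule LIMSEQ_unique)
  then show "expectation (\<lambda>\<omega>. enat_power s (?N \<omega>)) = exp (- (\<mu> * integral\<^sup>L lborel ?q) * (1 - s))"
    by (simp add: mult.assoc mult.commute)
qed


end

section \<open>The number of covering base stations\<close>

lemma inverse_ennreal_le_iff:
  assumes "0 < T"
  shows "inverse (ennreal a) \<le> ennreal T \<longleftrightarrow> 1 / T \<le> a"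
proof (cases "0 < a")
  case True
  then have "inverse (ennreal a) \<le> ennreal T \<longleftrightarrow> inverse a \<le> T"
    using assms by (simp add: inverse_ennreal ennreal_le_iff)
  then show ?thesis
    using True assms by (simp add: field_simps)
next
  case False
  then have "ennreal a = 0"
    by (simp add: ennreal_eq_0_iff)
  moreover have "0 < 1 / T"
    using assms by simp
  then have "\<not> 1 / T \<le> a"
    using False by linarith
  ultimately show ?thesis by (simp add: top_unique)
qed

text \<open>
  Below \<open>c'\<close> the infimum is one over finitely many values, so it is attained or at least \<open>c'\<close>.
\<close>

lemma less_INF_iff_of_finite:
  fixes f :: "'i \<Rightarrow> 'a::complete_linorder"
  assumes fin: "finite {i. f i \<le> c'}" and "c < c'"
  shows "c < (INF i. f i) \<longleftrightarrow> (\<forall>i. c < f i)"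
proof
  assume "\<forall>i. c < f i"
  let ?S = "insert c' (f ` {i. f i \<le> c'})"
  have "Min ?S \<le> f i" for i
    using fin by (cases "f i \<le> c'") (auto intro: Min_le order_trans[of _ c'])
  then have "Min ?S \<le> (INF i. f i)"
    by (intro INF_greatest)
  moreover have "c < Min ?S"
    using fin \<open>\<forall>i. c < f i\<close> \<open>c < c'\<close> by simp
  ultimately show "c < (INF i. f i)" by (rule less_le_trans[rotated])
qed (meson INF_lower UNIV_I less_le_trans)

text \<open>
  The marking theorem with the fading as mark. The covering region \<open>K\<close> has sections of probability
  \<open>p (z - x)\<close>, where \<open>p z\<close> agrees with the integrand of the mean coverage area wherever \<open>L z > 0\<close>,
  hence almost everywhere; translation invariance removes the dependence on \<open>x\<close>.
\<close>

lemma (in prob_space) num_covering_poisson: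
  fixes y :: "nat \<Rightarrow> 'a \<Rightarrow> 'b::euclidean_space" and h :: "nat \<Rightarrow> 'b \<Rightarrow> 'a \<Rightarrow> real"
  assumes y: "homogeneous_poisson_process M \<mu> y" and \<mu>: "0 \<le> \<mu>"
    and L: "L \<in> borel_measurable borel" "AE z in lborel. L z > 0"
    and H: "H \<in> borel_measurable M"
    and h: "indep_vars (\<lambda>_. borel) (\<lambda>i. h i x) UNIV" "\<And>i. distr M borel (h i x) = distr M borel H"
    and yh: "indep_set (sets (vimage_algebra (space M) (\<lambda>\<omega> i. y i \<omega>) (\<Pi>\<^sub>M i\<in>UNIV. borel)))
      (sets (vimage_algebra (space M) (\<lambda>\<omega> i. h i x \<omega>) (\<Pi>\<^sub>M i\<in>UNIV. borel)))"
    and fin: "mean_coverage_area M H L T < \<infinity>" and T: "T > 0"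
  shows "poisson_distributed M (num_covering y h L T x) (\<mu> * enn2real (mean_coverage_area M H L T))"
proof -
  note L(1)[measurable] H[measurable]
  define \<nu> where "\<nu> = distr M borel H"
  define K where "K = {p \<in> space (borel \<Otimes>\<^sub>M borel). 1 / T \<le> snd p * L (fst p - x)}"
  define p where "p z = measure \<nu> {w. 1 / T \<le> w * L z}" for z
  interpret \<nu>: prob_space \<nu>
    unfolding \<nu>_def by (rule prob_space_distr) simp
  have K_meas: "K \<in> sets (borel \<Otimes>\<^sub>M borel)"
    unfolding K_def by measurable
  have section_K: "measure \<nu> {w \<in> space borel. (z, w) \<in> K} = p (z - x)" for z
    by (simp add: K_def p_def space_pair_measure)
  have p_meas[measurable]: "p \<in> borel_measurable borel"
  proof -
    have "{q \<in> space (borel \<Otimes>\<^sub>M \<nu>). 1 / T \<le> snd q * L (fst q)} \<in> sets (borel \<Otimes>\<^sub>M \<nu>)"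
      unfolding \<nu>_def by measurable
    from \<nu>.measurable_emeasure_Pair[OF this]
    have "(\<lambda>z. emeasure \<nu> {w. 1 / T \<le> w * L z}) \<in> borel_measurable borel"
      by (simp add: space_pair_measure vimage_def \<nu>_def)
    then show ?thesis
      unfolding p_def measure_def by measurable
  qed
  have p_ccdf: "p z = ccdf M H (inverse (L z * T))" if "L z > 0" for z
  proof -
    have "p z = prob {\<omega> \<in> space M. 1 / T \<le> H \<omega> * L z}"
      unfolding p_def \<nu>_def by (subst measure_distr) (auto intro!: arg_cong[where f = prob])
    also have "{\<omega> \<in> space M. 1 / T \<le> H \<omega> * L z} = {\<omega> \<in> space M. inverse (L z * T) \<le> H \<omega>}"
      using that T by (auto simp: field_simps)
    finally show ?thesis by (simp add: ccdf_def)
  qed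
  have "(\<integral>\<^sup>+ z. ennreal (p (z - x)) \<partial>lborel) = (\<integral>\<^sup>+ z. ennreal (p z) \<partial>distr lborel borel ((+) (- x)))"
    by (subst nn_integral_distr) auto
  also have "\<dots> = (\<integral>\<^sup>+ z. ennreal (p z) \<partial>lborel)"
    by (simp only: lborel_distr_plus)
  also have "\<dots> = mean_coverage_area M H L T"
    unfolding mean_coverage_area_def
    by (rule nn_integral_cong_AE) (use L(2) in eventually_elim, simp add: p_ccdf)
  finally have nn: "(\<integral>\<^sup>+ z. ennreal (p (z - x)) \<partial>lborel) = mean_coverage_area M H L T" .
  have p_nonneg: "0 \<le> p z" for z
    by (simp add: p_def)
  have int: "integrable lborel (\<lambda>z. p (z - x))"
    using fin by (intro integrableI_nonneg) (simp_all add: nn p_nonneg)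
  have integral: "(\<integral>z. p (z - x) \<partial>lborel) = enn2real (mean_coverage_area M H L T)"
    by (subst integral_eq_nn_integral) (simp_all add: nn p_nonneg)
  have "poisson_distributed M (\<lambda>\<omega>. ecard {i. (y i \<omega>, h i x \<omega>) \<in> K})
      (\<mu> * (\<integral>z. measure \<nu> {w \<in> space borel. (z, w) \<in> K} \<partial>lborel))"
  proof (rule marked_poisson_process_count[OF y \<mu> yh h(1) _ K_meas])
    show "distr M borel (h i x) = \<nu>" for i
      by (simp only: h(2) \<nu>_def)
    show "integrable lborel (\<lambda>z. measure \<nu> {w \<in> space borel. (z, w) \<in> K})"
      by (simp only: section_K int)
  qed
  moreover have "covers y h L T x i \<omega> \<longleftrightarrow> (y i \<omega>, h i x \<omega>) \<in> K" for i \<omega>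
    using T by (simp add: covers_def path_loss_fading_def inverse_ennreal_le_iff K_def space_pair_measure)
  then have "num_covering y h L T x = (\<lambda>\<omega>. ecard {i. (y i \<omega>, h i x \<omega>) \<in> K})"
    by (simp add: num_covering_def fun_eq_iff)
  ultimately show ?thesis
    by (simp only: section_K integral)
qed

theorem corollary5:
  fixes M :: "'w measure"
    and lambdaB T :: real
    and y :: "nat \<Rightarrow> 'w \<Rightarrow> real ^ 2"
    and L :: "real ^ 2 \<Rightarrow> real"
    and H :: "'w \<Rightarrow> real"
    and pH :: "real \<Rightarrow> real"
    and h :: "nat \<Rightarrow> real ^ 2 \<Rightarrow> 'w \<Rightarrow> real"
  assumes "prob_space M"
    and "lambdaB > 0"
    and "homogeneous_poisson_process M lambdaB y"
    and "L \<in> borel_measurable borel"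
    and "AE z in lborel. L z > 0"
    and "AE \<omega> in M. H \<omega> \<ge> 0"
    and "\<And>t. pH t \<ge> 0"
    and "distributed M lborel H (\<lambda>t. ennreal (pH t))"
    and "\<And>\<beta>. ccdf M H \<beta> > 0"
    and "\<And>x. prob_space.indep_vars M (\<lambda>_. borel) (\<lambda>i. h i x) UNIV"
    and "\<And>x i. distr M borel (h i x) = distr M borel H"
    and "\<And>x. prob_space.indep_set M
               (sets (vimage_algebra (space M) (\<lambda>\<omega> i. y i \<omega>) (\<Pi>\<^sub>M i\<in>UNIV. borel)))
               (sets (vimage_algebra (space M) (\<lambda>\<omega> i. h i x \<omega>) (\<Pi>\<^sub>M i\<in>UNIV. borel)))"
    and "\<And>\<beta>. \<beta> > 0 \<Longrightarrow> 0 < mean_coverage_area M H L \<beta> \<and> mean_coverage_area M H L \<beta> < \<infinity>"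
    and "T > 0"
  shows "\<forall>x. poisson_distributed M (num_covering y h L T x) (lambdaB * enn2real (mean_coverage_area M H L T))
    \<and> measure M {\<omega> \<in> space M. outage y h L T x \<omega>}
        = measure M {\<omega> \<in> space M. ordered_fading y h L x 0 \<omega> > ennreal T}
    \<and> measure M {\<omega> \<in> space M. ordered_fading y h L x 0 \<omega> > ennreal T}
        = exp (- lambdaB * enn2real (mean_coverage_area M H L T))"
proof
  fix x :: "real ^ 2"
  interpret prob_space M by fact
  note L[measurable] = assms(4)
  have y[measurable]: "y i \<in> borel_measurable M" for i
    using assms(3) by (simp add: homogeneous_poisson_process_def)
  have h[measurable]: "h i x \<in> borel_measurable M" for i
    using assms(10)[of x] by (auto simp: indep_vars_def)
  have H: "H \<in> borel_measurable M"
    using assms(8) by (auto simp: distributed_def)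
  have poisson: "poisson_distributed M (num_covering y h L t x)
      (lambdaB * enn2real (mean_coverage_area M H L t))" if "t > 0" for t
    using assms(2) assms(13)[of t] that
    by (intro num_covering_poisson assms(3,4,5,10,11,12) H) auto
  let ?outage = "{\<omega> \<in> space M. outage y h L T x \<omega>}"
  let ?above = "{\<omega> \<in> space M. ordered_fading y h L x 0 \<omega> > ennreal T}"
  have s_meas[measurable]: "path_loss_fading y h L x i \<in> borel_measurable M" for i
    unfolding path_loss_fading_def by measurable
  \<comment> \<open>any threshold above \<open>T\<close> would do; the point is that no values accumulate at \<open>T\<close>\<close>
  have "AE \<omega> in M. num_covering y h L (T + 1) x \<omega> \<noteq> \<infinity>"
    using assms(14) by (intro AE_poisson_distributed_finite[OF poisson]) simp
  then have "AE \<omega> in M. \<omega> \<in> ?outage \<longleftrightarrow> \<omega> \<in> ?above"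
  proof eventually_elim
    case (elim \<omega>)
    then have "finite {i. path_loss_fading y h L x i \<omega> \<le> ennreal (T + 1)}"
      by (simp add: num_covering_def covers_def ecard_def split: if_splits)
    moreover have "ennreal T < ennreal (T + 1)"
      using assms(14) by (simp add: ennreal_less_iff)
    ultimately show ?case
      by (simp add: outage_def covers_def ordered_fading_def less_INF_iff_of_finite not_le)
  qed
  then have "prob ?outage = prob ?above"
    unfolding outage_def covers_def ordered_fading_def increasing_arrangement.simps
    by (intro finite_measure_eq_AE) measurable
  moreover have "?outage = {\<omega> \<in> space M. num_covering y h L T x \<omega> = 0}"
    by (auto simp: outage_def num_covering_def ecard_def zero_enat_def)
  then have "prob ?outage = exp (- lambdaB * enn2real (mean_coverage_area M H L T))"
    using prob_poisson_distributed_eq_0[OF poisson[OF assms(14)]] assms(2) by simp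
  ultimately show "poisson_distributed M (num_covering y h L T x) (lambdaB * enn2real (mean_coverage_area M H L T))
    \<and> prob ?outage = prob ?above
    \<and> prob ?above = exp (- lambdaB * enn2real (mean_coverage_area M H L T))"
    using poisson[OF assms(14)] by simp
qed

end
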